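(* Let $(\mathcal X,p(y|x),\mathcal Y)$ be a discrete memoryless channel and $p_0(x)$ an input distribution. Generate the codebook at random according to $p_0(x)$, reserving only the $\epsilon$-strongly typical codewords. Let $\mathbf C$ be the source's codebook with rate $R$, and $X^n$, $Y^n$ the input and output of the channel. Suppose $R>I_0(X;Y)$. Then: 1) $Y^n$ can be encoded at rate $R_1$ and recovered with arbitrarily low probability of error (as $n\to\infty$) if $R_1>H_0(Y)$, by an encoder and a decoder that do not use $\mathbf C$. 2) If $\mathbf C$ is available to both the encoder and the decoder and $Y^n$ is encoded at rate $R_2$ with $R_2<H_0(Y)$, then the decoding probability of error is bounded away from zero (as $n\to\infty$).
   Context: $\mathcal X,\mathcal Y$ are finite alphabets; the memoryless channel has $p(y^n|x^n)=\prod_k p(y_k|x_k)$. Logarithms are base 2. $H_0(Y)$, $I_0(X;Y)$ are computed from $p_0(x,y)=p_0(x)p(y|x)$. Quantities such as $2^{nR}$ are treated as integers. For $\epsilon>0$, $A^{(n)}_{\epsilon,0}(X)$ (the $\epsilon$-strongly typical sequences) is the set of $x^n\in\mathcal X^n$ with $|\frac1nN(a|x^n)-p_0(a)|<\epsilon/|\mathcal X|$ for all $a$ with $p_0(a)>0$ and $N(a|x^n)=0$ for all $a$ with $p_0(a)=0$, where $N(a|x^n)$ is the number of occurrences of $a$ in $x^n$. Random codebook generation: $\mathbf C=\{X^n(w): w=1,\dots,2^{nR}\}$ where the codewords are independent, each with distribution $p(x^n)=\Pr(\tilde X^n=x^n\mid\tilde X^n\in A^{(n)}_{\epsilon,0}(X))$,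 $\tilde X^n$ i.i.d. according to $p_0(x)$; here $\epsilon>0$ is fixed. The message $W$ is uniform on $\{1,\dots,2^{nR}\}$, independent of $\mathbf C$; the channel input is $X^n=X^n(W)$ and $Y^n$ is the resulting channel output. Compression without codebook information at rate $R_1$: an encoder $f:\mathcal Y^n\to\{1,\dots,2^{nR_1}\}$ and a decoder $g:\{1,\dots,2^{nR_1}\}\to\mathcal Y^n$, with error probability $\Pr(g(f(Y^n))\ne Y^n)$. Compression with codebook information at rate $R_2$: an encoder $I=f(Y^n,\mathbf C)\in\{1,\dots,2^{nR_2}\}$ and a decoder $g(I,\mathbf C)\in\mathcal Y^n$, with error probability $P_e^{(n)}=\Pr(g(I,\mathbf C)\ne Y^n)$. Part 2) concerns every sequence (in $n$) of such codes; "bounded away from zero" means $\liminf_{n\to\infty}P_e^{(n)}>0$. *)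

theory Defs
  imports "HOL-Probability.Probability"
begin

text \<open>
  The finite alphabets are finite types. A sequence of length \<open>n\<close> is a function on \<open>{..<n}\<close>,
  extended by \<^const>\<open>undefined\<close>, which is also the default value given to \<^const>\<open>Pi_pmf\<close> below.
\<close>

definition block :: "nat \<Rightarrow> (nat \<Rightarrow> 'a) set" where
  "block n = {..<n} \<rightarrow>\<^sub>E UNIV"

text \<open>The integer standing for \<open>2\<^sup>n\<^sup>R\<close>; rounding is downwards for all rates.\<close>

definition num_idx :: "real \<Rightarrow> nat \<Rightarrow> nat" where
  "num_idx R n = nat \<lfloor>2 powr (real n * R)\<rfloor>"

definition joint :: "'x pmf \<Rightarrow> ('x \<Rightarrow> 'y pmf) \<Rightarrow> ('x \<times> 'y) pmf" where
  "joint p0 ch = do {x \<leftarrow> p0; y \<leftarrow> ch x; return_pmf (x, y)}"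

definition output_entropy :: "'x pmf \<Rightarrow> ('x \<Rightarrow> 'y pmf) \<Rightarrow> real" where
  "output_entropy p0 ch =
     prob_space.entropy (measure_pmf (joint p0 ch)) 2 (count_space UNIV) snd"

definition mutual_info :: "'x pmf \<Rightarrow> ('x \<Rightarrow> 'y pmf) \<Rightarrow> real" where
  "mutual_info p0 ch =
     prob_space.mutual_information (measure_pmf (joint p0 ch)) 2
       (count_space UNIV) (count_space UNIV) fst snd"

definition iid :: "'a pmf \<Rightarrow> nat \<Rightarrow> (nat \<Rightarrow> 'a) pmf" where
  "iid p n = Pi_pmf {..<n} undefined (\<lambda>_. p)"

definition memoryless :: "('x \<Rightarrow> 'y pmf) \<Rightarrow> nat \<Rightarrow> (nat \<Rightarrow> 'x) \<Rightarrow> (nat \<Rightarrow> 'y) pmf" where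
  "memoryless ch n x = Pi_pmf {..<n} undefined (\<lambda>k. ch (x k))"

definition occ :: "nat \<Rightarrow> 'a \<Rightarrow> (nat \<Rightarrow> 'a) \<Rightarrow> nat" where
  "occ n a x = card {k \<in> {..<n}. x k = a}"

definition strongly_typical :: "'a::finite pmf \<Rightarrow> real \<Rightarrow> nat \<Rightarrow> (nat \<Rightarrow> 'a) set" where
  "strongly_typical p \<epsilon> n = {x \<in> block n.
     (\<forall>a. pmf p a > 0 \<longrightarrow> \<bar>real (occ n a x) / real n - pmf p a\<bar> < \<epsilon> / real CARD('a)) \<and>
     (\<forall>a. pmf p a = 0 \<longrightarrow> occ n a x = 0)}"

text \<open>
  The conditional law below is unspecified when the typical set has probability zero. For
  \<open>\<epsilon> > 0\<close> this concerns only finitely many \<open>n\<close>, by the law of large numbers.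
\<close>

definition codeword :: "'x::finite pmf \<Rightarrow> real \<Rightarrow> nat \<Rightarrow> (nat \<Rightarrow> 'x) pmf" where
  "codeword p0 \<epsilon> n = cond_pmf (iid p0 n) (strongly_typical p0 \<epsilon> n)"

definition random_codebook ::
    "'x::finite pmf \<Rightarrow> real \<Rightarrow> real \<Rightarrow> nat \<Rightarrow> (nat \<Rightarrow> nat \<Rightarrow> 'x) pmf" where
  "random_codebook p0 \<epsilon> R n = Pi_pmf {1..num_idx R n} undefined (\<lambda>_. codeword p0 \<epsilon> n)"

definition codebooks :: "real \<Rightarrow> nat \<Rightarrow> (nat \<Rightarrow> nat \<Rightarrow> 'x) set" where
  "codebooks R n = {1..num_idx R n} \<rightarrow>\<^sub>E block n"

text \<open>The joint law of the codebook and the channel output.\<close>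

definition codebook_output ::
    "'x::finite pmf \<Rightarrow> ('x \<Rightarrow> 'y pmf) \<Rightarrow> real \<Rightarrow> real \<Rightarrow> nat \<Rightarrow>
     ((nat \<Rightarrow> nat \<Rightarrow> 'x) \<times> (nat \<Rightarrow> 'y)) pmf" where
  "codebook_output p0 ch \<epsilon> R n = do {
     C \<leftarrow> random_codebook p0 \<epsilon> R n;
     w \<leftarrow> pmf_of_set {1..num_idx R n};
     y \<leftarrow> memoryless ch n (C w);
     return_pmf (C, y)}"

definition blind_code ::
    "real \<Rightarrow> nat \<Rightarrow> ((nat \<Rightarrow> 'y) \<Rightarrow> nat) \<Rightarrow> (nat \<Rightarrow> nat \<Rightarrow> 'y) \<Rightarrow> bool" where
  "blind_code R1 n f g \<longleftrightarrow>
     f \<in> block n \<rightarrow> {1..num_idx R1 n} \<and> g \<in> {1..num_idx R1 n} \<rightarrow> block n"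

definition blind_error ::
    "'x::finite pmf \<Rightarrow> ('x \<Rightarrow> 'y pmf) \<Rightarrow> real \<Rightarrow> real \<Rightarrow> nat \<Rightarrow>
     ((nat \<Rightarrow> 'y) \<Rightarrow> nat) \<Rightarrow> (nat \<Rightarrow> nat \<Rightarrow> 'y) \<Rightarrow> real" where
  "blind_error p0 ch \<epsilon> R n f g =
     measure_pmf.prob (codebook_output p0 ch \<epsilon> R n) {(C, y). g (f y) \<noteq> y}"

definition informed_code ::
    "real \<Rightarrow> real \<Rightarrow> nat \<Rightarrow> ((nat \<Rightarrow> 'y) \<Rightarrow> (nat \<Rightarrow> nat \<Rightarrow> 'x) \<Rightarrow> nat) \<Rightarrow>
     (nat \<Rightarrow> (nat \<Rightarrow> nat \<Rightarrow> 'x) \<Rightarrow> nat \<Rightarrow> 'y) \<Rightarrow> bool" where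
  "informed_code R R2 n f g \<longleftrightarrow>
     f \<in> block n \<rightarrow> codebooks R n \<rightarrow> {1..num_idx R2 n} \<and>
     g \<in> {1..num_idx R2 n} \<rightarrow> codebooks R n \<rightarrow> block n"

definition informed_error ::
    "'x::finite pmf \<Rightarrow> ('x \<Rightarrow> 'y pmf) \<Rightarrow> real \<Rightarrow> real \<Rightarrow> nat \<Rightarrow>
     ((nat \<Rightarrow> 'y) \<Rightarrow> (nat \<Rightarrow> nat \<Rightarrow> 'x) \<Rightarrow> nat) \<Rightarrow>
     (nat \<Rightarrow> (nat \<Rightarrow> nat \<Rightarrow> 'x) \<Rightarrow> nat \<Rightarrow> 'y) \<Rightarrow> real" where
  "informed_error p0 ch \<epsilon> R n f g =
     measure_pmf.prob (codebook_output p0 ch \<epsilon> R n) {(C, y). g (f y C) C \<noteq> y}"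

end

theory Submission
  imports Defs "HOL-Real_Asymp.Real_Asymp"
begin

text \<open>
  Since the typical set eventually has probability at least 1/2, conditioning the codewords on it
  at most doubles expectations of nonnegative functions, so every event that is unlikely for i.i.d.
  inputs stays unlikely for a transmitted codeword. For achievability, enumerate the output
  sequences of i.i.d. probability at least \<open>2\<^sup>-\<^sup>n\<^sup>R\<^sup>1\<close>: there are at most \<open>2\<^sup>n\<^sup>R\<^sup>1\<close> of them.

  For the converse, given the codebook a decoder can only be right on \<open>2\<^sup>n\<^sup>R\<^sup>2\<close> output sequences.
  The output law given the codebook is an average over \<open>2\<^sup>n\<^sup>R\<close> independent codewords; when
  \<open>R > I\<^sub>0\<close> and atypical input-output pairs are discarded, its expected squared \<open>\<ell>\<^sup>2\<close> norm is only
  about \<open>2\<^sup>-\<^sup>n\<^sup>H\<close>. Hence its mass on any \<open>2\<^sup>n\<^sup>R\<^sup>2\<close> points vanishes when \<open>R2 < H\<close>, and the error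
  probability even tends to 1.
\<close>

section \<open>Conditional laws and products of probability mass functions\<close>

lemma measure_bind_pmf_expectation:
  "measure_pmf.prob (bind_pmf p f) A = measure_pmf.expectation p (\<lambda>x. measure_pmf.prob (f x) A)"
proof -
  have int: "integrable p (\<lambda>x. measure_pmf.prob (f x) A)"
    by (rule measure_pmf.integrable_const_bound[where B = 1]) auto
  have "ennreal (measure_pmf.prob (bind_pmf p f) A) = (\<integral>\<^sup>+x. emeasure (f x) A \<partial>p)"
    by (simp flip: measure_pmf.emeasure_eq_measure)
  also have "\<dots> = (\<integral>\<^sup>+x. ennreal (measure_pmf.prob (f x) A) \<partial>p)"
    by (simp add: measure_pmf.emeasure_eq_measure)
  also have "\<dots> = ennreal (measure_pmf.expectation p (\<lambda>x. measure_pmf.prob (f x) A))"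
    by (rule nn_integral_eq_integral[OF int]) auto
  finally show ?thesis by (simp add: integral_nonneg_AE)
qed

text \<open>Conditioning multiplies each weight inside \<open>A\<close> by \<open>1 / prob A\<close>
  and deletes the others. As \<open>f\<close> is nonnegative, putting the deleted terms back only
  increases the sum.\<close>

lemma expectation_cond_pmf_le:
  fixes f :: "'a \<Rightarrow> real"
  assumes "finite (set_pmf p)" "set_pmf p \<inter> A \<noteq> {}" "\<And>x. f x \<ge> 0"
  shows "measure_pmf.expectation (cond_pmf p A) f
           \<le> measure_pmf.expectation p f / measure_pmf.prob p A"
proof -
  have "measure_pmf.expectation (cond_pmf p A) f
          = (\<Sum>x\<in>set_pmf p. f x * pmf (cond_pmf p A) x)"
    using assms(1,2) by (intro integral_measure_pmf_real) auto
  also have "\<dots> \<le> (\<Sum>x\<in>set_pmf p. f x * pmf p x / measure_pmf.prob p A)"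
    using assms by (intro sum_mono) (auto simp: pmf_cond)
  also have "\<dots> = measure_pmf.expectation p f / measure_pmf.prob p A"
    using assms(1) by (subst integral_measure_pmf_real[of "set_pmf p"])
      (auto simp: sum_divide_distrib)
  finally show ?thesis .
qed

lemma prob_bind_cond_pmf_le:
  assumes "finite (set_pmf p)" "set_pmf p \<inter> A \<noteq> {}"
  shows "measure_pmf.prob (bind_pmf (cond_pmf p A) f) B
           \<le> measure_pmf.prob (bind_pmf p f) B / measure_pmf.prob p A"
  unfolding measure_bind_pmf_expectation using assms by (intro expectation_cond_pmf_le) auto

lemma finite_set_Pi_pmf:
  assumes "finite I" "\<And>i. i \<in> I \<Longrightarrow> finite (set_pmf (p i))"
  shows "finite (set_pmf (Pi_pmf I d p))"
  using assms by (simp add: set_Pi_pmf finite_PiE_dflt)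

lemma expectation_Pi_pmf_component:
  fixes f :: "'a \<Rightarrow> real"
  assumes "finite I" "i \<in> I"
  shows "measure_pmf.expectation (Pi_pmf I d p) (\<lambda>C. f (C i)) = measure_pmf.expectation (p i) f"
proof -
  have "measure_pmf.expectation (Pi_pmf I d p) (\<lambda>C. f (C i))
          = measure_pmf.expectation (map_pmf (\<lambda>C. C i) (Pi_pmf I d p)) f"
    by simp
  also have "map_pmf (\<lambda>C. C i) (Pi_pmf I d p) = p i"
    using assms by (simp add: Pi_pmf_component)
  finally show ?thesis .
qed

lemma expectation_Pi_pmf_two_components:
  fixes f :: "'a \<Rightarrow> real"
  assumes "finite I" "i \<in> I" "j \<in> I" "i \<noteq> j" "finite (set_pmf P)" "\<And>x. f x \<ge> 0"
  shows "measure_pmf.expectation (Pi_pmf I d (\<lambda>_. P)) (\<lambda>C. f (C i) * f (C j))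
           = (measure_pmf.expectation P f)\<^sup>2"
proof -
  \<comment> \<open>Filling the other coordinates with the constant 1 turns two factors into a
    product over all of \<open>I\<close>, to which independence applies.\<close>
  define F where "F k = (if k \<in> {i, j} then f else (\<lambda>_. 1))" for k
  have prod: "(\<Prod>k\<in>I. G k) = G i * G j"
    if "\<And>k. k \<in> I \<Longrightarrow> k \<notin> {i, j} \<Longrightarrow> G k = 1" for G :: "_ \<Rightarrow> real"
  proof -
    have "(\<Prod>k\<in>I. G k) = (\<Prod>k\<in>{i, j}. G k)"
      using assms that by (intro prod.mono_neutral_right) auto
    thus ?thesis using \<open>i \<noteq> j\<close> by simp
  qed
  have "(\<Prod>k\<in>I. F k (C k)) = f (C i) * f (C j)" for C
    by (subst prod) (auto simp: F_def)
  hence "measure_pmf.expectation (Pi_pmf I d (\<lambda>_. P)) (\<lambda>C. f (C i) * f (C j))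
          = measure_pmf.expectation (Pi_pmf I d (\<lambda>_. P)) (\<lambda>C. \<Prod>k\<in>I. F k (C k))"
    by simp
  also have "\<dots> = (\<Prod>k\<in>I. measure_pmf.expectation P (F k))"
    using assms by (intro expectation_prod_Pi_pmf)
      (auto simp: F_def integrable_measure_pmf_finite)
  also have "\<dots> = (measure_pmf.expectation P f)\<^sup>2"
    by (subst prod) (auto simp: F_def power2_eq_square)
  finally show ?thesis .
qed

section \<open>A one-shot bound for decoding with a random codebook\<close>

text \<open>Expanding the square gives diagonal terms, at most \<open>b * e\<close> because
  \<open>f x * f x \<le> b * f x\<close> on the support, and off-diagonal terms, equal to
  \<open>e\<^sup>2\<close> by independence. Only \<open>card I\<close> of the pairs are diagonal, so
  the normalization damps them by \<open>1 / card I\<close>.\<close>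

lemma second_moment_average_le:
  fixes f :: "'a \<Rightarrow> real" and I :: "'i set"
  assumes I: "finite I" "I \<noteq> {}" and P: "finite (set_pmf P)"
    and f: "\<And>x. f x \<ge> 0" "\<And>x. x \<in> set_pmf P \<Longrightarrow> f x \<le> b"
  defines "e \<equiv> measure_pmf.expectation P f"
  shows "measure_pmf.expectation (Pi_pmf I d (\<lambda>_. P)) (\<lambda>C. ((\<Sum>i\<in>I. f (C i)) / real (card I))\<^sup>2)
           \<le> b * e / real (card I) + e\<^sup>2"
proof -
  let ?E = "measure_pmf.expectation (Pi_pmf I d (\<lambda>_. P))"
  let ?K = "real (card I)"
  have K: "?K > 0" using I by (simp add: card_gt_0_iff)
  have e: "e \<ge> 0" unfolding e_def using f by (intro integral_nonneg_AE) auto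
  have b: "b \<ge> 0" using f set_pmf_not_empty[of P] by (meson all_not_in_conv order.trans)
  have int: "integrable (Pi_pmf I d (\<lambda>_. P)) g" for g :: "_ \<Rightarrow> real"
    using I P by (intro integrable_measure_pmf_finite finite_set_Pi_pmf) auto
  have intP: "integrable P g" for g :: "_ \<Rightarrow> real"
    using P by (intro integrable_measure_pmf_finite) auto
  have diag: "?E (\<lambda>C. f (C i) * f (C i)) \<le> b * e" if "i \<in> I" for i
  proof -
    have "?E (\<lambda>C. f (C i) * f (C i)) = measure_pmf.expectation P (\<lambda>x. f x * f x)"
      using I that by (rule_tac expectation_Pi_pmf_component[where f = "\<lambda>x. f x * f x"]) auto
    also have "\<dots> \<le> measure_pmf.expectation P (\<lambda>x. b * f x)"
      using f by (intro integral_mono_AE intP AE_pmfI mult_right_mono) auto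
    finally show ?thesis by (simp add: e_def)
  qed
  \<comment> \<open>The diagonal also receives \<open>e\<^sup>2\<close>; this overcount makes the
    sum over all pairs immediate.\<close>
  have le: "?E (\<lambda>C. f (C i) * f (C j)) \<le> (if i = j then b * e else 0) + e\<^sup>2"
    if "i \<in> I" "j \<in> I" for i j
    using that I P f diag[of i] expectation_Pi_pmf_two_components[of I i j P f d]
    by (cases "i = j") (auto simp: e_def intro: add_increasing2)
  have "?E (\<lambda>C. ((\<Sum>i\<in>I. f (C i)) / ?K)\<^sup>2)
          = ?E (\<lambda>C. (\<Sum>i\<in>I. \<Sum>j\<in>I. f (C i) * f (C j)) / ?K\<^sup>2)"
    by (simp add: power_divide power2_eq_square sum_product)
  also have "\<dots> = (\<Sum>i\<in>I. \<Sum>j\<in>I. ?E (\<lambda>C. f (C i) * f (C j))) / ?K\<^sup>2"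
    using int by (simp add: Bochner_Integration.integral_sum)
  also have "\<dots> \<le> (\<Sum>i\<in>I. \<Sum>j\<in>I. (if i = j then b * e else 0) + e\<^sup>2) / ?K\<^sup>2"
    by (intro divide_right_mono sum_mono le) auto
  also have "\<dots> = (?K * (b * e) + ?K\<^sup>2 * e\<^sup>2) / ?K\<^sup>2"
    using I by (simp add: sum.distrib power2_eq_square algebra_simps)
  also have "\<dots> = b * e / ?K + e\<^sup>2"
    using K by (simp add: field_simps power2_eq_square)
  finally show ?thesis .
qed

lemma expectation_pmf_of_set:
  fixes f :: "'a \<Rightarrow> real"
  assumes "finite I" "I \<noteq> {}"
  shows "measure_pmf.expectation (pmf_of_set I) f = (\<Sum>i\<in>I. f i) / real (card I)"
  using integral_pmf_of_set[OF assms(2,1)] by simp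

text \<open>\<open>S C\<close> stands for the outputs decoded correctly under the codebook
  \<open>C\<close>, and \<open>G\<close> for the typical pairs. Mass outside \<open>G\<close> is
  paid for directly. The rest is an average over independent codewords whose expected squares sum to
  at most \<open>b / card I + c\<close>; comparison with the threshold \<open>a\<close> turns this
  into a bound on the mass of any \<open>M\<close> points.\<close>

lemma informed_success_le:
  fixes P :: "'a pmf" and W :: "'a \<Rightarrow> 'b pmf" and I :: "'i set"
  assumes I: "finite I" "I \<noteq> {}" and P: "finite (set_pmf P)"
    and B: "finite B" "\<And>x. x \<in> set_pmf P \<Longrightarrow> set_pmf (W x) \<subseteq> B"
    and b: "\<And>x y. x \<in> set_pmf P \<Longrightarrow> y \<in> B \<Longrightarrow> (x, y) \<in> G \<Longrightarrow> pmf (W x) y \<le> b" "b \<ge> 0"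
    and c: "\<And>y. y \<in> B \<Longrightarrow> measure_pmf.expectation P (\<lambda>x. pmf (W x) y * indicator G (x, y)) \<le> c"
    and S: "\<And>C. C \<in> set_pmf (Pi_pmf I d (\<lambda>_. P)) \<Longrightarrow> real (card (S C \<inter> B)) \<le> M"
    and a: "a > 0"
  shows "measure_pmf.prob
           (do {C \<leftarrow> Pi_pmf I d (\<lambda>_. P); i \<leftarrow> pmf_of_set I; y \<leftarrow> W (C i); return_pmf (C, y)})
           {(C, y). y \<in> S C}
         \<le> measure_pmf.prob (do {x \<leftarrow> P; y \<leftarrow> W x; return_pmf (x, y)}) (- G)
             + a * M + (b / real (card I) + c) / a"
proof -
  define Q where "Q = Pi_pmf I d (\<lambda>_. P)"
  define K where "K = real (card I)"
  \<comment> \<open>\<open>W1\<close> is the channel law with the pairs outside \<open>G\<close>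
    discarded, \<open>V\<close> its average over the codebook, \<open>\<beta>\<close> the discarded
    mass, and \<open>e\<close> the mean of \<open>V\<close> over random codebooks.\<close>
  define W1 where "W1 x y = pmf (W x) y * indicator G (x, y)" for x y
  define V where "V C y = (\<Sum>i\<in>I. W1 (C i) y) / K" for C y
  define \<beta> where "\<beta> x = measure_pmf.prob (W x) {y. (x, y) \<notin> G}" for x
  define e where "e y = measure_pmf.expectation P (\<lambda>x. W1 x y)" for y
  have K: "K > 0" using I by (simp add: card_gt_0_iff K_def)
  have Q: "finite (set_pmf Q)" unfolding Q_def using I P by (intro finite_set_Pi_pmf) auto
  have int: "integrable Q g" for g :: "_ \<Rightarrow> real"
    using Q by (rule integrable_measure_pmf_finite)
  have intP: "integrable P g" for g :: "_ \<Rightarrow> real"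
    using P by (rule integrable_measure_pmf_finite)
  have Q_P: "C i \<in> set_pmf P" if "C \<in> set_pmf Q" "i \<in> I" for C i
    using that I by (auto simp: Q_def set_Pi_pmf PiE_dflt_def)
  have W1: "W1 x y \<ge> 0" "W1 x y \<le> pmf (W x) y" for x y
    by (auto simp: W1_def indicator_def)
  have V: "V C y \<ge> 0" for C y
    unfolding V_def using W1 K by (intro divide_nonneg_pos sum_nonneg) auto
  have e: "e y \<ge> 0" for y
    unfolding e_def using W1 by (intro integral_nonneg_AE) auto
  have e_sum: "(\<Sum>y\<in>B. e y) \<le> 1"
  proof -
    have "(\<Sum>y\<in>B. e y) = measure_pmf.expectation P (\<lambda>x. \<Sum>y\<in>B. W1 x y)"
      unfolding e_def using intP by (simp add: Bochner_Integration.integral_sum)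
    also have "\<dots> \<le> measure_pmf.expectation P (\<lambda>x. 1)"
    proof (intro integral_mono_AE intP AE_pmfI)
      fix x assume "x \<in> set_pmf P"
      have "(\<Sum>y\<in>B. W1 x y) \<le> (\<Sum>y\<in>B. pmf (W x) y)"
        by (intro sum_mono W1)
      also have "\<dots> = 1" using B \<open>x \<in> set_pmf P\<close> by (intro sum_pmf_eq_1) auto
      finally show "(\<Sum>y\<in>B. W1 x y) \<le> 1" .
    qed
    finally show ?thesis by simp
  qed
  \<comment> \<open>Bounding only one factor of \<open>(e y)\<^sup>2\<close> by \<open>c\<close>
    leaves a factor \<open>e y\<close>, whose sum over \<open>B\<close> is at most 1 by
    \<open>e_sum\<close>.\<close>
  have second: "measure_pmf.expectation Q (\<lambda>C. (V C y)\<^sup>2) \<le> (b / K + c) * e y" if "y \<in> B" for y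
  proof -
    have "measure_pmf.expectation Q (\<lambda>C. (V C y)\<^sup>2) \<le> b * e y / K + (e y)\<^sup>2"
      unfolding Q_def V_def K_def e_def using W1 b that
      by (intro second_moment_average_le I P) (auto simp: W1_def indicator_def)
    also have "(e y)\<^sup>2 \<le> c * e y"
      unfolding power2_eq_square using c[OF that] e[of y]
      by (intro mult_right_mono) (auto simp: e_def W1_def)
    finally show ?thesis by (simp add: algebra_simps)
  qed
  have split: "measure_pmf.prob (W x) T \<le> \<beta> x + (\<Sum>y\<in>T \<inter> B. W1 x y)"
    if "x \<in> set_pmf P" for x T
  proof -
    \<comment> \<open>Outputs outside \<open>B\<close> have probability zero under
      \<open>W x\<close>, so only the discarded outputs and the good ones inside \<open>B\<close>
      count.\<close>
    have "measure_pmf.prob (W x) T \<le> measure_pmf.prob (W x) ({y. (x, y) \<notin> G} \<union> {y \<in> T \<inter> B. (x, y) \<in> G})"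
      using B that by (intro measure_pmf.finite_measure_mono_AE) (auto simp: AE_measure_pmf_iff)
    also have "\<dots> \<le> \<beta> x + measure_pmf.prob (W x) {y \<in> T \<inter> B. (x, y) \<in> G}"
      unfolding \<beta>_def by (intro measure_Un_le) auto
    also have "measure_pmf.prob (W x) {y \<in> T \<inter> B. (x, y) \<in> G} = (\<Sum>y\<in>T \<inter> B. W1 x y)"
      using B by (subst measure_measure_pmf_finite)
        (auto simp: W1_def indicator_def sum.inter_filter intro!: sum.cong)
    finally show ?thesis .
  qed
  have pointwise: "(\<Sum>i\<in>I. measure_pmf.prob (W (C i)) (S C)) / K
      \<le> (\<Sum>i\<in>I. \<beta> (C i)) / K + a * M + (\<Sum>y\<in>B. (V C y)\<^sup>2) / a" if C: "C \<in> set_pmf Q" for C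
  proof -
    \<comment> \<open>Values up to \<open>a\<close> are charged to the number of decodable points, larger ones to the second moment.\<close>
    have V_le: "V C y \<le> a + (V C y)\<^sup>2 / a" for y
    proof (cases "V C y \<le> a")
      case False
      hence "V C y * a \<le> V C y * V C y" using V by (intro mult_left_mono) auto
      hence "V C y \<le> (V C y)\<^sup>2 / a" using a by (simp add: field_simps power2_eq_square)
      thus ?thesis using a by simp
    qed (use a in \<open>simp add: add_increasing2\<close>)
    have "(\<Sum>i\<in>I. measure_pmf.prob (W (C i)) (S C)) / K
        \<le> (\<Sum>i\<in>I. \<beta> (C i) + (\<Sum>y\<in>S C \<inter> B. W1 (C i) y)) / K"
      using K C Q_P by (intro divide_right_mono sum_mono split) auto
    also have "\<dots> = (\<Sum>i\<in>I. \<beta> (C i)) / K + (\<Sum>y\<in>S C \<inter> B. V C y)"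
      unfolding V_def sum.distrib add_divide_distrib
      by (subst sum.swap) (simp add: sum_divide_distrib)
    also have "(\<Sum>y\<in>S C \<inter> B. V C y) \<le> (\<Sum>y\<in>S C \<inter> B. a + (V C y)\<^sup>2 / a)"
      by (intro sum_mono V_le)
    also have "\<dots> = a * real (card (S C \<inter> B)) + (\<Sum>y\<in>S C \<inter> B. (V C y)\<^sup>2) / a"
      by (simp add: sum.distrib sum_divide_distrib)
    also have "\<dots> \<le> a * M + (\<Sum>y\<in>B. (V C y)\<^sup>2) / a"
      using a S[of C] C B unfolding Q_def
      by (intro add_mono divide_right_mono sum_mono2 mult_left_mono) auto
    finally show ?thesis by simp
  qed
  have "measure_pmf.prob
           (do {C \<leftarrow> Q; i \<leftarrow> pmf_of_set I; y \<leftarrow> W (C i); return_pmf (C, y)}) {(C, y). y \<in> S C}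
        = measure_pmf.expectation Q (\<lambda>C. (\<Sum>i\<in>I. measure_pmf.prob (W (C i)) (S C)) / K)"
    unfolding map_pmf_def[symmetric]
    by (simp add: measure_bind_pmf_expectation expectation_pmf_of_set I K_def vimage_def)
  also have "\<dots> \<le> measure_pmf.expectation Q
      (\<lambda>C. (\<Sum>i\<in>I. \<beta> (C i)) / K + a * M + (\<Sum>y\<in>B. (V C y)\<^sup>2) / a)"
    by (intro integral_mono_AE int AE_pmfI pointwise)
  also have "\<dots> = (\<Sum>i\<in>I. measure_pmf.expectation Q (\<lambda>C. \<beta> (C i))) / K + a * M
      + (\<Sum>y\<in>B. measure_pmf.expectation Q (\<lambda>C. (V C y)\<^sup>2)) / a"
    by (simp add: Bochner_Integration.integral_sum int)
  also have "(\<Sum>i\<in>I. measure_pmf.expectation Q (\<lambda>C. \<beta> (C i))) / K = measure_pmf.expectation P \<beta>"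
    using I K by (simp add: Q_def expectation_Pi_pmf_component K_def)
  also have "measure_pmf.expectation P \<beta>
      = measure_pmf.prob (do {x \<leftarrow> P; y \<leftarrow> W x; return_pmf (x, y)}) (- G)"
    unfolding map_pmf_def[symmetric]
    by (simp add: measure_bind_pmf_expectation \<beta>_def[abs_def] vimage_def)
  also have "(\<Sum>y\<in>B. measure_pmf.expectation Q (\<lambda>C. (V C y)\<^sup>2)) / a \<le> (\<Sum>y\<in>B. (b / K + c) * e y) / a"
    using a by (intro divide_right_mono sum_mono second) auto
  also have "(\<Sum>y\<in>B. (b / K + c) * e y) \<le> (b / K + c) * 1"
  proof -
    \<comment> \<open>The factor \<open>b / K + c\<close> has to be nonnegative. The sign of
      \<open>c\<close> comes from \<open>0 \<le> e y \<le> c\<close> at any point of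
      \<open>B\<close>, which is nonempty because it contains the support of an output law.\<close>
    have "B \<noteq> {}" using B(2) set_pmf_not_empty by (metis all_not_in_conv subset_empty)
    then obtain y where "y \<in> B" by blast
    hence "e y \<le> c" unfolding e_def W1_def by (rule c)
    hence "c \<ge> 0" using e[of y] by simp
    thus ?thesis unfolding sum_distrib_left[symmetric]
      using e_sum b K by (intro mult_left_mono) auto
  qed
  finally show ?thesis using a by (simp add: Q_def K_def divide_right_mono)
qed

section \<open>Weak laws and strong typicality\<close>

text \<open>On a finite alphabet \<open>h\<close> is bounded, so Hoeffding's inequality applies and
  the deviation probability even decays exponentially.\<close>

lemma iid_weak_law:
  fixes q :: "'a::finite pmf" and h :: "'a \<Rightarrow> real"
  assumes "\<delta> > 0"
  shows "(\<lambda>n. measure_pmf.prob (iid q n)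
            {z. \<bar>(\<Sum>k<n. h (z k)) - real n * measure_pmf.expectation q h\<bar> \<ge> real n * \<delta>}) \<longlonglongrightarrow> 0"
proof -
  \<comment> \<open>The added 1 keeps the Hoeffding interval nondegenerate even for
    \<open>h = 0\<close>.\<close>
  define B where "B = Max (range (\<lambda>x. \<bar>h x\<bar>)) + 1"
  have h: "\<bar>h x\<bar> < B" for x
  proof -
    have "\<bar>h x\<bar> \<le> Max (range (\<lambda>x. \<bar>h x\<bar>))" by (rule Max_ge) auto
    thus ?thesis unfolding B_def by linarith
  qed
  hence B: "B > 0" by (meson abs_ge_zero le_less_trans)
  \<comment> \<open>Hoeffding's exponent with \<open>n\<close> intervals of length
    \<open>2 * B\<close>:
    \<open>2 * (n * \<delta>)\<^sup>2 / (n * (2 * B)\<^sup>2) = r * n\<close>.\<close>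
  define r where "r = \<delta>\<^sup>2 / (2 * B\<^sup>2)"
  have bound: "measure_pmf.prob (iid q n)
        {z. \<bar>(\<Sum>k<n. h (z k)) - real n * measure_pmf.expectation q h\<bar> \<ge> real n * \<delta>}
      \<le> 2 * exp (- (r * real n))" if "n > 0" for n
  proof -
    let ?M = "measure_pmf (iid q n)"
    have E: "measure_pmf.expectation (iid q n) (\<lambda>z. h (z k)) = measure_pmf.expectation q h"
      if "k < n" for k
      using that by (simp add: iid_def expectation_Pi_pmf_component)
    interpret Hoeffding_ineq ?M "{..<n}" "\<lambda>k z. h (z k)" "\<lambda>_. - B" "\<lambda>_. B"
        "real n * measure_pmf.expectation q h"
    proof unfold_locales
      show "prob_space.indep_vars ?M (\<lambda>_. borel) (\<lambda>k z. h (z k)) {..<n}"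
        unfolding iid_def
        by (intro prob_space.indep_vars_compose2[OF _ indep_vars_Pi_pmf])
           (auto simp: measure_pmf.prob_space_axioms)
      show "AE z in ?M. h (z k) \<in> {- B..B}" for k
        using h by (auto simp: abs_less_iff less_imp_le minus_less_iff)
    qed (auto simp: E)
    have "measure_pmf.prob (iid q n)
        {z. \<bar>(\<Sum>k<n. h (z k)) - real n * measure_pmf.expectation q h\<bar> \<ge> real n * \<delta>}
      \<le> 2 * exp (- 2 * (real n * \<delta>)\<^sup>2 / (\<Sum>k<n. (B - - B)\<^sup>2))"
      using Hoeffding_ineq_abs_ge[of "real n * \<delta>"] assms B that by simp
    also have "- 2 * (real n * \<delta>)\<^sup>2 / (\<Sum>k<n. (B - - B)\<^sup>2) = - (r * real n)"
      using B that by (simp add: r_def field_simps power2_eq_square)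
    finally show ?thesis .
  qed
  show ?thesis
  proof (rule tendsto_sandwich[OF _ _ tendsto_const])
    show "\<forall>\<^sub>F n in sequentially. measure_pmf.prob (iid q n)
        {z. \<bar>(\<Sum>k<n. h (z k)) - real n * measure_pmf.expectation q h\<bar> \<ge> real n * \<delta>}
      \<le> 2 * exp (- (r * real n))"
      using eventually_gt_at_top[of 0] by eventually_elim (rule bound)
    have "r > 0" using assms B by (simp add: r_def)
    thus "(\<lambda>n. 2 * exp (- (r * real n))) \<longlonglongrightarrow> 0"
      by real_asymp
  qed simp
qed

text \<open>A pair of sequences rather than a sequence of pairs: this is the shape in which a
  codeword and its channel output occur, while the weak law speaks of sequences of pairs.\<close>

definition seq_joint :: "'x pmf \<Rightarrow> ('x \<Rightarrow> 'y pmf) \<Rightarrow> nat \<Rightarrow> ((nat \<Rightarrow> 'x) \<times> (nat \<Rightarrow> 'y)) pmf" where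
  "seq_joint p0 ch n = do {x \<leftarrow> iid p0 n; y \<leftarrow> memoryless ch n x; return_pmf (x, y)}"

text \<open>Zipping translates between the two shapes. The case distinction is there because the
  default outside \<open>{..<n}\<close> is \<open>undefined\<close> of the pair type, not a pair of
  two defaults.\<close>

lemma iid_joint:
  "iid (joint p0 ch) n =
     map_pmf (\<lambda>(x, y) k. if k < n then (x k, y k) else undefined) (seq_joint p0 ch n)"
  by (simp add: iid_def joint_def seq_joint_def memoryless_def map_bind_pmf
      Pi_pmf_bind[where d' = undefined])

text \<open>Independent coordinates stay independent when each passes through its own channel use.
  This makes the output law under unconditioned inputs a product law.\<close>

lemma iid_bind:
  "iid (bind_pmf p0 ch) n = bind_pmf (iid p0 n) (memoryless ch n)"
  by (simp add: iid_def memoryless_def[abs_def] Pi_pmf_bind[where d' = undefined])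

lemma seq_joint_weak_law:
  fixes p0 :: "'x::finite pmf" and ch :: "'x \<Rightarrow> 'y::finite pmf" and h :: "'x \<times> 'y \<Rightarrow> real"
  assumes "\<delta> > 0"
  shows "(\<lambda>n. measure_pmf.prob (seq_joint p0 ch n)
            {(x, y). \<bar>(\<Sum>k<n. h (x k, y k)) - real n * measure_pmf.expectation (joint p0 ch) h\<bar>
                        \<ge> real n * \<delta>}) \<longlonglongrightarrow> 0"
  using iid_weak_law[OF assms, of "joint p0 ch" h]
  by (simp add: iid_joint vimage_def case_prod_unfold)

section \<open>Supports and product formulas for the laws of sequences\<close>

lemma finite_block: "finite (block n :: (nat \<Rightarrow> 'a::finite) set)"
  unfolding block_def by (intro finite_PiE) auto

lemma set_memoryless_block: "set_pmf (memoryless ch n x) \<subseteq> block n"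
  by (auto simp: memoryless_def set_Pi_pmf PiE_dflt_def block_def)

lemma set_iid_block: "set_pmf (iid p n) \<subseteq> block n"
  by (auto simp: iid_def set_Pi_pmf PiE_dflt_def block_def)

lemma finite_set_iid: "finite (set_pmf (iid (p :: 'a::finite pmf) n))"
  using set_iid_block finite_block finite_subset by blast

lemma pmf_memoryless:
  "y \<in> block n \<Longrightarrow> pmf (memoryless ch n x) y = (\<Prod>k<n. pmf (ch (x k)) (y k))"
  unfolding memoryless_def block_def by (subst pmf_Pi') (auto simp: PiE_def extensional_def)

lemma pmf_iid: "y \<in> block n \<Longrightarrow> pmf (iid p n) y = (\<Prod>k<n. pmf p (y k))"
  unfolding iid_def block_def by (subst pmf_Pi') (auto simp: PiE_def extensional_def)

lemma set_iid_component: "x \<in> set_pmf (iid p n) \<Longrightarrow> k < n \<Longrightarrow> x k \<in> set_pmf p"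
  by (auto simp: iid_def set_Pi_pmf PiE_dflt_def)

lemma set_memoryless_component:
  "y \<in> set_pmf (memoryless ch n x) \<Longrightarrow> k < n \<Longrightarrow> y k \<in> set_pmf (ch (x k))"
  by (auto simp: memoryless_def set_Pi_pmf PiE_dflt_def)

text \<open>Outside the typical set some symbol frequency is off by at least
  \<open>\<epsilon> / CARD('a)\<close>. The weak law for the indicator of each symbol and a union
  bound over the finite alphabet make this unlikely.\<close>

lemma prob_strongly_typical_tendsto:
  fixes p :: "'a::finite pmf"
  assumes "\<epsilon> > 0"
  shows "(\<lambda>n. measure_pmf.prob (iid p n) (strongly_typical p \<epsilon> n)) \<longlonglongrightarrow> 1"
proof -
  define \<delta> where "\<delta> = \<epsilon> / real CARD('a)"
  have \<delta>: "\<delta> > 0" using assms by (simp add: \<delta>_def)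
  define D where "D a n = {z :: nat \<Rightarrow> 'a. \<bar>(\<Sum>k<n. indicator {a} (z k)) - real n * measure_pmf.expectation p (indicator {a})\<bar> \<ge> real n * \<delta>}" for a n
  have lower: "1 - (\<Sum>a\<in>UNIV. measure_pmf.prob (iid p n) (D a n))
      \<le> measure_pmf.prob (iid p n) (strongly_typical p \<epsilon> n)" if "n > 0" for n
  proof -
    have sub: "z \<in> (\<Union>a. D a n)" if z: "z \<in> set_pmf (iid p n)" "z \<notin> strongly_typical p \<epsilon> n" for z
    proof -
      have occ: "(\<Sum>k<n. indicator {a} (z k)) = real (occ n a z)" for a
        by (simp add: occ_def indicator_def sum.If_cases Int_def)
      \<comment> \<open>Symbols of probability zero never occur in a sequence from the support, so
        atypicality must come from a frequency deviation.\<close>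
      have "occ n a z = 0" if "pmf p a = 0" for a
        using set_iid_component[OF z(1)] that by (auto simp: occ_def set_pmf_iff)
      moreover have "z \<in> block n" using z set_iid_block by blast
      ultimately obtain a where a: "\<not> \<bar>real (occ n a z) / real n - pmf p a\<bar> < \<delta>"
        using z(2) by (auto simp: strongly_typical_def \<delta>_def)
      have "real n * \<delta> \<le> real n * \<bar>real (occ n a z) / real n - pmf p a\<bar>"
        using a by (intro mult_left_mono) auto
      also have "\<dots> = \<bar>real n * (real (occ n a z) / real n - pmf p a)\<bar>"
        by (simp add: abs_mult)
      also have "real n * (real (occ n a z) / real n - pmf p a) = real (occ n a z) - real n * pmf p a"
        using \<open>n > 0\<close> by (simp add: right_diff_distrib)
      finally have "z \<in> D a n"
        by (simp add: D_def occ pmf.rep_eq)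
      thus ?thesis by blast
    qed
    have "measure_pmf.prob (iid p n) (- strongly_typical p \<epsilon> n)
        \<le> measure_pmf.prob (iid p n) (\<Union>a. D a n)"
      using sub by (intro measure_pmf.finite_measure_mono_AE) (auto simp: AE_measure_pmf_iff)
    also have "\<dots> \<le> (\<Sum>a\<in>UNIV. measure_pmf.prob (iid p n) (D a n))"
      by (intro measure_pmf.finite_measure_subadditive_finite) auto
    finally show ?thesis
      using measure_pmf.prob_compl[of "strongly_typical p \<epsilon> n" "iid p n"]
      by (simp add: Compl_eq_Diff_UNIV)
  qed
  have "(\<lambda>n. \<Sum>a\<in>UNIV. measure_pmf.prob (iid p n) (D a n)) \<longlonglongrightarrow> (\<Sum>a\<in>(UNIV :: 'a set). 0)"
    unfolding D_def by (intro tendsto_sum iid_weak_law \<delta>)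
  hence "(\<lambda>n. 1 - (\<Sum>a\<in>UNIV. measure_pmf.prob (iid p n) (D a n))) \<longlonglongrightarrow> 1"
    using tendsto_diff[OF tendsto_const] by fastforce
  thus ?thesis
  proof (rule tendsto_sandwich[OF _ _ _ tendsto_const, rotated 2])
    show "\<forall>\<^sub>F n in sequentially. 1 - (\<Sum>a\<in>UNIV. measure_pmf.prob (iid p n) (D a n))
      \<le> measure_pmf.prob (iid p n) (strongly_typical p \<epsilon> n)"
      using eventually_gt_at_top[of 0] by eventually_elim (rule lower)
  qed simp
qed

section \<open>Asymptotic equipartition\<close>

lemma map_fst_joint: "map_pmf fst (joint p0 ch) = p0"
  by (simp add: joint_def map_bind_pmf bind_return_pmf')

lemma map_snd_joint: "map_pmf snd (joint p0 ch) = bind_pmf p0 ch"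
  by (simp add: joint_def map_bind_pmf bind_return_pmf')

lemma pmf_joint:
  fixes p0 :: "'x::finite pmf"
  shows "pmf (joint p0 ch) (x, y) = pmf p0 x * pmf (ch x) y"
proof -
  have eq: "pmf (map_pmf (Pair x') (ch x')) (x, y) = (if x' = x then pmf (ch x) y else 0)" for x'
    by (auto simp: pmf_map vimage_def pmf.rep_eq)
  show ?thesis
    unfolding joint_def map_pmf_def[symmetric] pmf_bind eq
    by (subst integral_measure_pmf_real[of "{x}"]) (auto split: if_splits)
qed

text \<open>Gives access to the finite-sum formulas for entropy and mutual information.\<close>

lemma simple_distributed_pmf:
  fixes M :: "'a::finite pmf" and X :: "'a \<Rightarrow> 'b"
  shows "simple_distributed (measure_pmf M) X (pmf (map_pmf X M))"
proof (rule measure_pmf.simple_distributedI)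
  show "simple_function (measure_pmf M) X" by (simp add: simple_function_def)
qed (auto simp: pmf_map)

lemma information_space_pmf: "information_space (measure_pmf M) 2"
  by unfold_locales simp

text \<open>As an expectation under the output law, the entropy becomes the limit value in the weak
  law for \<open>- log 2 (pmf q y)\<close>.\<close>

lemma output_entropy_eq:
  fixes p0 :: "'x::finite pmf" and ch :: "'x \<Rightarrow> 'y::finite pmf"
  shows "output_entropy p0 ch
           = measure_pmf.expectation (bind_pmf p0 ch) (\<lambda>y. - log 2 (pmf (bind_pmf p0 ch) y))"
proof -
  interpret information_space "measure_pmf (joint p0 ch)" 2 by (rule information_space_pmf)
  \<comment> \<open>The finite-sum formula wants the counting space on the range of the variable,
    which for \<open>snd\<close> is all of \<open>UNIV\<close>.\<close>
  have "output_entropy p0 ch = prob_space.entropy (measure_pmf (joint p0 ch)) 2 (count_space (snd ` space (measure_pmf (joint p0 ch)))) snd"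
    by (simp add: output_entropy_def)
  also have "\<dots> = - (\<Sum>y\<in>UNIV. pmf (bind_pmf p0 ch) y * log 2 (pmf (bind_pmf p0 ch) y))"
    by (subst entropy_simple_distributed[OF simple_distributed_pmf]) (simp add: map_snd_joint)
  finally show ?thesis
    by (subst integral_measure_pmf_real[of UNIV]) (simp_all add: sum_negf mult.commute)
qed

lemma mutual_info_eq:
  fixes p0 :: "'x::finite pmf" and ch :: "'x \<Rightarrow> 'y::finite pmf"
  shows "mutual_info p0 ch = measure_pmf.expectation (joint p0 ch)
           (\<lambda>z. log 2 (pmf (ch (fst z)) (snd z) / pmf (bind_pmf p0 ch) (snd z)))"
    and mutual_info_nonneg: "mutual_info p0 ch \<ge> 0"
proof -
  interpret information_space "measure_pmf (joint p0 ch)" 2 by (rule information_space_pmf)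
  have eq: "mutual_info p0 ch = prob_space.mutual_information (measure_pmf (joint p0 ch)) 2
      (count_space (fst ` space (measure_pmf (joint p0 ch))))
      (count_space (snd ` space (measure_pmf (joint p0 ch)))) fst snd"
    by (simp add: mutual_info_def)
  have "mutual_info p0 ch = (\<Sum>(x, y)\<in>UNIV. pmf (joint p0 ch) (x, y) *
      log 2 (pmf (joint p0 ch) (x, y) / (pmf p0 x * pmf (bind_pmf p0 ch) y)))"
    unfolding eq
    by (subst mutual_information_simple_distributed[OF simple_distributed_pmf simple_distributed_pmf
        simple_distributed_pmf]) (simp add: map_fst_joint map_snd_joint)
  \<comment> \<open>The factor \<open>pmf p0 x\<close> cancels inside the logarithm; where it
    vanishes, both summands have weight zero.\<close>
  also have "\<dots> = (\<Sum>z\<in>UNIV. log 2 (pmf (ch (fst z)) (snd z) / pmf (bind_pmf p0 ch) (snd z))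
      * pmf (joint p0 ch) z)"
    by (intro sum.cong) (auto simp: pmf_joint)
  finally show "mutual_info p0 ch = measure_pmf.expectation (joint p0 ch)
      (\<lambda>z. log 2 (pmf (ch (fst z)) (snd z) / pmf (bind_pmf p0 ch) (snd z)))"
    by (subst integral_measure_pmf_real[of UNIV]) auto
  show "mutual_info p0 ch \<ge> 0"
    unfolding eq by (rule mutual_information_nonneg_simple) (auto simp: simple_function_def)
qed

lemma output_entropy_nonneg:
  fixes p0 :: "'x::finite pmf" and ch :: "'x \<Rightarrow> 'y::finite pmf"
  shows "output_entropy p0 ch \<ge> 0"
  unfolding output_entropy_eq
  by (intro integral_nonneg_AE AE_pmfI) (simp add: pmf_positive pmf_le_1)

section \<open>Logarithms of products and rounded powers of two\<close>

lemma log_prod_sum: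
  fixes f :: "'a \<Rightarrow> real"
  assumes "finite I" "\<And>i. i \<in> I \<Longrightarrow> f i \<noteq> 0"
  shows "log b (\<Prod>i\<in>I. f i) = (\<Sum>i\<in>I. log b (f i))"
  using assms by (simp add: log_def ln_prod sum_divide_distrib)

lemma num_idx_le: "real (num_idx R n) \<le> 2 powr (real n * R)"
  by (simp add: num_idx_def)

lemma le_num_idx: "real m \<le> 2 powr (real n * R) \<Longrightarrow> m \<le> num_idx R n"
  unfolding num_idx_def by (rule le_nat_floor)

lemma num_idx_ge_1: "R \<ge> 0 \<Longrightarrow> 1 \<le> num_idx R n"
  by (rule le_num_idx) (simp add: ge_one_powr_ge_zero)

text \<open>Rounding down to an integer \<open>m \<ge> 1\<close> costs at most a factor 2, since the
  rounded number is below \<open>m + 1 \<le> 2 * m\<close>.\<close>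

lemma num_idx_ge_half:
  assumes "R \<ge> 0"
  shows "2 powr (real n * R) / 2 \<le> real (num_idx R n)"
proof -
  have "2 powr (real n * R) \<ge> 1" using assms by (simp add: ge_one_powr_ge_zero)
  hence "1 \<le> real (num_idx R n)" using num_idx_ge_1[OF assms, of n] by simp
  moreover have "2 powr (real n * R) < real (num_idx R n) + 1"
    unfolding num_idx_def by linarith
  ultimately show ?thesis by simp
qed

text \<open>Minus the logarithm of the sequence probability is a sum of i.i.d. terms with mean
  \<open>H\<close>. The lower bound serves achievability, the upper bound the converse.\<close>

lemma iid_output_aep:
  fixes p0 :: "'x::finite pmf" and ch :: "'x \<Rightarrow> 'y::finite pmf"
  assumes "\<delta> > 0"
  defines "q \<equiv> bind_pmf p0 ch" and "H \<equiv> output_entropy p0 ch"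
  shows "(\<lambda>n. measure_pmf.prob (iid q n)
            {y. \<not> (2 powr (- (real n * (H + \<delta>))) \<le> pmf (iid q n) y \<and>
                   pmf (iid q n) y \<le> 2 powr (- (real n * (H - \<delta>))))}) \<longlonglongrightarrow> 0"
    (is "(\<lambda>n. measure_pmf.prob _ (?A n)) \<longlonglongrightarrow> 0")
proof (rule tendsto_sandwich[OF _ _ tendsto_const])
  let ?D = "\<lambda>n. {y. \<bar>(\<Sum>k<n. - log 2 (pmf q (y k)))
      - real n * measure_pmf.expectation q (\<lambda>y. - log 2 (pmf q y))\<bar> \<ge> real n * \<delta>}"
  show "(\<lambda>n. measure_pmf.prob (iid q n) (?D n)) \<longlonglongrightarrow> 0"
    by (rule iid_weak_law[OF assms(1)])
  show "\<forall>\<^sub>F n in sequentially. measure_pmf.prob (iid q n) (?A n) \<le> measure_pmf.prob (iid q n) (?D n)"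
  \<comment> \<open>The inclusion is needed only on the support, where all factors are nonzero and
    the logarithm of the product splits.\<close>
  proof (rule always_eventually, rule allI, intro measure_pmf.finite_measure_mono_AE AE_pmfI impI)
    fix n y assume y: "y \<in> set_pmf (iid q n)" "y \<in> ?A n"
    have pos: "pmf (iid q n) y > 0" using y by (simp add: pmf_positive)
    have "pmf (iid q n) y = (\<Prod>k<n. pmf q (y k))"
      using y set_iid_block by (intro pmf_iid) blast
    moreover have "pmf q (y k) \<noteq> 0" if "k < n" for k
      using set_iid_component[OF y(1) that] by (simp add: set_pmf_iff)
    ultimately have "log 2 (pmf (iid q n) y) = (\<Sum>k<n. log 2 (pmf q (y k)))"
      by (subst log_prod_sum[symmetric]) auto
    hence eq: "(\<Sum>k<n. - log 2 (pmf q (y k))) = - log 2 (pmf (iid q n) y)"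
      by (simp add: sum_negf)
    have H: "H = measure_pmf.expectation q (\<lambda>y. - log 2 (pmf q y))"
      unfolding H_def q_def by (rule output_entropy_eq)
    have "pmf (iid q n) y = 2 powr (log 2 (pmf (iid q n) y))" using pos by simp
    hence "\<not> (- (real n * (H + \<delta>)) \<le> log 2 (pmf (iid q n) y) \<and>
              log 2 (pmf (iid q n) y) \<le> - (real n * (H - \<delta>)))"
      using y(2) by (metis (mono_tags, lifting) mem_Collect_eq powr_le_cancel_iff one_less_numeral_iff semiring_norm(76))
    thus "y \<in> ?D n"
      unfolding mem_Collect_eq eq H[symmetric] by (auto simp: algebra_simps)
  qed auto
qed auto

text \<open>The logarithm of the likelihood ratio is a sum of single-letter information densities,
  whose mean under the joint law is the mutual information.\<close>

lemma information_density_aep: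
  fixes p0 :: "'x::finite pmf" and ch :: "'x \<Rightarrow> 'y::finite pmf"
  assumes "\<delta> > 0"
  defines "q \<equiv> bind_pmf p0 ch" and "J \<equiv> mutual_info p0 ch"
  shows "(\<lambda>n. measure_pmf.prob (seq_joint p0 ch n)
            {(x, y). \<not> pmf (memoryless ch n x) y \<le> 2 powr (real n * (J + \<delta>)) * pmf (iid q n) y}) \<longlonglongrightarrow> 0"
    (is "(\<lambda>n. measure_pmf.prob _ (?A n)) \<longlonglongrightarrow> 0")
proof (rule tendsto_sandwich[OF _ _ tendsto_const])
  define h where "h z = log 2 (pmf (ch (fst z)) (snd z) / pmf q (snd z))" for z
  let ?D = "\<lambda>n. {(x, y). \<bar>(\<Sum>k<n. h (x k, y k))
      - real n * measure_pmf.expectation (joint p0 ch) h\<bar> \<ge> real n * \<delta>}"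
  show "(\<lambda>n. measure_pmf.prob (seq_joint p0 ch n) (?D n)) \<longlonglongrightarrow> 0"
    by (rule seq_joint_weak_law[OF assms(1)])
  show "\<forall>\<^sub>F n in sequentially.
      measure_pmf.prob (seq_joint p0 ch n) (?A n) \<le> measure_pmf.prob (seq_joint p0 ch n) (?D n)"
  proof (rule always_eventually, rule allI, intro measure_pmf.finite_measure_mono_AE AE_pmfI impI)
    fix n z
    assume z: "z \<in> set_pmf (seq_joint p0 ch n)" "z \<in> ?A n"
    obtain x y where z_eq: "z = (x, y)" by (cases z)
    have xy: "(x, y) \<in> set_pmf (seq_joint p0 ch n)"
      and A: "\<not> pmf (memoryless ch n x) y \<le> 2 powr (real n * (J + \<delta>)) * pmf (iid q n) y"
      using z z_eq by auto
    have x: "x \<in> set_pmf (iid p0 n)" and y: "y \<in> set_pmf (memoryless ch n x)"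
      using xy by (auto simp: seq_joint_def)
    \<comment> \<open>Anything reachable from a possible input lies in the support of the output
      law, so the denominator of the likelihood ratio is positive.\<close>
    hence "y \<in> set_pmf (iid q n)" by (auto simp: q_def iid_bind)
    hence pos: "pmf (iid q n) y > 0" "pmf (memoryless ch n x) y > 0"
      using y by (simp_all add: pmf_positive)
    have block: "y \<in> block n" using y set_memoryless_block by blast
    have nz: "pmf (ch (x k)) (y k) \<noteq> 0" "pmf q (y k) \<noteq> 0" if "k < n" for k
      using set_memoryless_component[OF y that] set_iid_component[OF \<open>y \<in> set_pmf (iid q n)\<close> that]
      by (simp_all add: set_pmf_iff)
    have "(\<Sum>k<n. h (x k, y k)) = log 2 (\<Prod>k<n. pmf (ch (x k)) (y k) / pmf q (y k))"
      using nz by (subst log_prod_sum) (auto simp: h_def)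
    also have "\<dots> = log 2 (pmf (memoryless ch n x) y / pmf (iid q n) y)"
      by (simp add: pmf_memoryless[OF block] pmf_iid[OF block] prod_dividef)
    finally have eq: "(\<Sum>k<n. h (x k, y k)) = log 2 (pmf (memoryless ch n x) y / pmf (iid q n) y)" .
    have "2 powr (real n * (J + \<delta>)) < pmf (memoryless ch n x) y / pmf (iid q n) y"
      using A pos by (simp add: field_simps)
    hence "real n * (J + \<delta>) < log 2 (pmf (memoryless ch n x) y / pmf (iid q n) y)"
      using pos by (simp add: less_log_iff)
    moreover have "J = measure_pmf.expectation (joint p0 ch) h"
      unfolding J_def h_def q_def by (rule mutual_info_eq)
    ultimately show "z \<in> ?D n"
      using eq z_eq by (simp add: algebra_simps)
  qed auto
qed auto

section \<open>Coding\<close>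

text \<open>An injection of \<open>T\<close> into the indices encodes \<open>T\<close>, and its
  inverse decodes it.\<close>

lemma blind_code_exists:
  fixes T :: "(nat \<Rightarrow> 'y) set"
  assumes "T \<subseteq> block n" "finite T" "card T \<le> num_idx R n" "1 \<le> num_idx R n"
  shows "\<exists>f g. blind_code R n f g \<and> (\<forall>y\<in>T. g (f y) = y)"
proof -
  obtain h where h: "h ` T \<subseteq> {1..num_idx R n}" "inj_on h T"
    using card_le_inj[of T "{1..num_idx R n}"] assms by auto
  \<comment> \<open>Elsewhere the values are arbitrary but must stay in range: index 1 for the
    encoder, and for the decoder \<open>restrict undefined {..<n}\<close>, which is an element of
    \<open>block n\<close>.\<close>
  define f where "f y = (if y \<in> T then h y else 1)" for y
  define g where "g i = (if i \<in> h ` T then inv_into T h i else restrict undefined {..<n})" for i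
  have "f \<in> block n \<rightarrow> {1..num_idx R n}"
    using h(1) assms(4) by (force simp: f_def)
  moreover have "g i \<in> block n" for i
    using inv_into_into[of i h T] assms(1) by (cases "i \<in> h ` T") (auto simp: g_def block_def)
  moreover have "g (f y) = y" if "y \<in> T" for y
    using that h(2) by (simp add: f_def g_def)
  ultimately show ?thesis unfolding blind_code_def by blast
qed

text \<open>All codewords have the same marginal law, so averaging over the message leaves the
  output law of a single random codeword.\<close>

lemma prob_codebook_output_snd:
  fixes p0 :: "'x::finite pmf" and ch :: "'x \<Rightarrow> 'y pmf"
  assumes "R \<ge> 0" "set_pmf (iid p0 n) \<inter> strongly_typical p0 \<epsilon> n \<noteq> {}"
  shows "measure_pmf.prob (codebook_output p0 ch \<epsilon> R n) {(C, y). y \<in> T}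
           = measure_pmf.prob (bind_pmf (codeword p0 \<epsilon> n) (memoryless ch n)) T"
proof -
  define P where "P = codeword p0 \<epsilon> n"
  define I where "I = {1..num_idx R n}"
  have I: "finite I" "I \<noteq> {}" using num_idx_ge_1[OF assms(1), of n] by (auto simp: I_def)
  have "finite (set_pmf P)"
    unfolding P_def codeword_def using assms(2) finite_set_iid[of p0 n] by simp
  hence int: "integrable (Pi_pmf I undefined (\<lambda>_. P)) g" for g :: "_ \<Rightarrow> real"
    using I by (intro integrable_measure_pmf_finite finite_set_Pi_pmf) auto
  have "measure_pmf.prob (codebook_output p0 ch \<epsilon> R n) {(C, y). y \<in> T}
      = measure_pmf.expectation (Pi_pmf I undefined (\<lambda>_. P))
          (\<lambda>C. (\<Sum>i\<in>I. measure_pmf.prob (memoryless ch n (C i)) T) / real (card I))"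
    unfolding codebook_output_def random_codebook_def map_pmf_def[symmetric] I_def[symmetric] P_def[symmetric]
    by (simp add: measure_bind_pmf_expectation expectation_pmf_of_set I vimage_def)
  also have "\<dots> = measure_pmf.expectation P (\<lambda>x. measure_pmf.prob (memoryless ch n x) T)"
  proof -
    have "measure_pmf.expectation (Pi_pmf I undefined (\<lambda>_. P))
        (\<lambda>C. measure_pmf.prob (memoryless ch n (C i)) T)
      = measure_pmf.expectation P (\<lambda>x. measure_pmf.prob (memoryless ch n x) T)" if "i \<in> I" for i
      using I that expectation_Pi_pmf_component[where f = "\<lambda>x. measure_pmf.prob (memoryless ch n x) T"]
      by fastforce
    thus ?thesis using I int by (simp add: Bochner_Integration.integral_sum)
  qed
  finally show ?thesis by (simp add: measure_bind_pmf_expectation P_def)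
qed

lemma eventually_typical_prob_ge_half:
  fixes p :: "'a::finite pmf"
  assumes "\<epsilon> > 0"
  shows "\<forall>\<^sub>F n in sequentially. measure_pmf.prob (iid p n) (strongly_typical p \<epsilon> n) \<ge> 1 / 2"
  using order_tendstoD(1)[OF prob_strongly_typical_tendsto[OF assms, of p], of "1 / 2"]
  by (auto elim: eventually_mono)

lemma set_pmf_Int_nonempty: "measure_pmf.prob p A > 0 \<Longrightarrow> set_pmf p \<inter> A \<noteq> {}"
  using measure_Int_set_pmf[of p A] by (auto simp: Int_commute)

lemma prob_bind_codeword_le:
  fixes p0 :: "'x::finite pmf"
  assumes "measure_pmf.prob (iid p0 n) (strongly_typical p0 \<epsilon> n) \<ge> 1 / 2"
  shows "measure_pmf.prob (bind_pmf (codeword p0 \<epsilon> n) F) B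
           \<le> 2 * measure_pmf.prob (bind_pmf (iid p0 n) F) B"
proof -
  let ?A = "strongly_typical p0 \<epsilon> n"
  have "set_pmf (iid p0 n) \<inter> ?A \<noteq> {}" using assms by (intro set_pmf_Int_nonempty) auto
  hence "measure_pmf.prob (bind_pmf (codeword p0 \<epsilon> n) F) B
      \<le> measure_pmf.prob (bind_pmf (iid p0 n) F) B / measure_pmf.prob (iid p0 n) ?A"
    unfolding codeword_def by (intro prob_bind_cond_pmf_le finite_set_iid)
  also have "\<dots> \<le> measure_pmf.prob (bind_pmf (iid p0 n) F) B / (1 / 2)"
    using assms by (intro divide_left_mono) auto
  finally show ?thesis by simp
qed

text \<open>The code is exact on \<open>T\<close>, so errors happen only off \<open>T\<close>. These
  are rare for i.i.d. inputs, and \<open>prob_bind_codeword_le\<close> carries this over to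
  codewords at the cost of a factor 2.\<close>

lemma blind_achievability:
  fixes p0 :: "'x::finite pmf" and ch :: "'x \<Rightarrow> 'y::finite pmf"
  assumes "\<epsilon> > 0" "R \<ge> 0" "R1 > output_entropy p0 ch"
  shows "\<exists>f g. (\<forall>n. blind_code R1 n (f n) (g n)) \<and>
               (\<lambda>n. blind_error p0 ch \<epsilon> R n (f n) (g n)) \<longlonglongrightarrow> 0"
proof -
  define q where "q = bind_pmf p0 ch"
  \<comment> \<open>With this choice the lower typicality bound
    \<open>2 powr (- (n * (H + \<delta>)))\<close> is exactly the threshold in
    \<open>T\<close>.\<close>
  define \<delta> where "\<delta> = R1 - output_entropy p0 ch"
  define T where "T n = {y \<in> block n. 2 powr (- (real n * R1)) \<le> pmf (iid q n) y}" for n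
  have \<delta>: "\<delta> > 0" using assms by (simp add: \<delta>_def)
  have R1: "R1 \<ge> 0" using assms output_entropy_nonneg[of p0 ch] by simp
  have finT: "finite (T n)" for n
    unfolding T_def by (simp add: finite_block)
  \<comment> \<open>Each point of \<open>T\<close> has mass at least
    \<open>2 powr (- (n * R1))\<close>, and the total mass is at most 1.\<close>
  have card: "card (T n) \<le> num_idx R1 n" for n
  proof (rule le_num_idx)
    have "real (card (T n)) * 2 powr (- (real n * R1)) = (\<Sum>y\<in>T n. 2 powr (- (real n * R1)))"
      by simp
    also have "\<dots> \<le> (\<Sum>y\<in>T n. pmf (iid q n) y)"
      by (intro sum_mono) (simp add: T_def)
    also have "\<dots> = measure_pmf.prob (iid q n) (T n)"
      using finT by (simp add: measure_measure_pmf_finite)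
    also have "\<dots> \<le> 1" by simp
    finally show "real (card (T n)) \<le> 2 powr (real n * R1)"
      by (simp add: powr_minus field_simps)
  qed
  have "\<exists>f g. blind_code R1 n f g \<and> (\<forall>y\<in>T n. g (f y) = y)" for n
    using finT card num_idx_ge_1[OF R1] by (intro blind_code_exists) (auto simp: T_def)
  then obtain f g where fg: "\<And>n. blind_code R1 n (f n) (g n)" "\<And>n y. y \<in> T n \<Longrightarrow> g n (f n y) = y"
    by metis
  have "(\<lambda>n. blind_error p0 ch \<epsilon> R n (f n) (g n)) \<longlonglongrightarrow> 0"
  proof (rule tendsto_sandwich[OF _ _ tendsto_const])
    let ?A = "\<lambda>n. {y. \<not> (2 powr (- (real n * (output_entropy p0 ch + \<delta>))) \<le> pmf (iid q n) y \<and>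
                   pmf (iid q n) y \<le> 2 powr (- (real n * (output_entropy p0 ch - \<delta>))))}"
    show "(\<lambda>n. 2 * measure_pmf.prob (iid q n) (?A n)) \<longlonglongrightarrow> 0"
      using tendsto_mult_left[OF iid_output_aep[OF \<delta>, of p0 ch], of 2] by (simp add: q_def)
    show "\<forall>\<^sub>F n in sequentially.
        blind_error p0 ch \<epsilon> R n (f n) (g n) \<le> 2 * measure_pmf.prob (iid q n) (?A n)"
      using eventually_typical_prob_ge_half[OF assms(1), of p0]
    proof eventually_elim
      case (elim n)
      hence "set_pmf (iid p0 n) \<inter> strongly_typical p0 \<epsilon> n \<noteq> {}"
        by (intro set_pmf_Int_nonempty) auto
      from prob_codebook_output_snd[OF assms(2) this, of ch "{y. g n (f n y) \<noteq> y}"]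
      have "blind_error p0 ch \<epsilon> R n (f n) (g n)
          = measure_pmf.prob (bind_pmf (codeword p0 \<epsilon> n) (memoryless ch n)) {y. g n (f n y) \<noteq> y}"
        by (simp add: blind_error_def)
      also have "\<dots> \<le> 2 * measure_pmf.prob (iid q n) {y. g n (f n y) \<noteq> y}"
        unfolding q_def iid_bind by (rule prob_bind_codeword_le[OF elim])
      also have "measure_pmf.prob (iid q n) {y. g n (f n y) \<noteq> y} \<le> measure_pmf.prob (iid q n) (?A n)"
      proof (intro measure_pmf.finite_measure_mono_AE AE_pmfI impI)
        fix y assume "y \<in> set_pmf (iid q n)" "y \<in> {y. g n (f n y) \<noteq> y}"
        hence "y \<in> block n" "y \<notin> T n" using fg(2)[of y n] set_iid_block by auto
        thus "y \<in> ?A n" by (simp add: T_def \<delta>_def)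
      qed simp
      finally show ?case by simp
    qed
  qed (auto simp: blind_error_def)
  with fg(1) show ?thesis by blast
qed

text \<open>The one-shot bound with \<open>b = v * u\<close>, \<open>c = 2 * u\<close> and
  \<open>M = 2 powr (n * R2)\<close>. Of the gap \<open>3 * \<delta>\<close>, one
  \<open>\<delta>\<close> goes to entropy typicality, one to the threshold \<open>a\<close>, and one
  remains as decay rate. The coefficient 5 is 1 from \<open>a * M\<close> plus 4 from the second
  moment.\<close>

lemma informed_success_bound:
  fixes p0 :: "'x::finite pmf" and ch :: "'x \<Rightarrow> 'y::finite pmf"
  assumes code: "informed_code R R2 n f g" and R: "R \<ge> J + \<delta>" "R \<ge> 0"
    and half: "measure_pmf.prob (iid p0 n) (strongly_typical p0 \<epsilon> n) \<ge> 1 / 2"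
    and H: "R2 + 3 * \<delta> \<le> H"
  defines "q \<equiv> bind_pmf p0 ch"
  shows "1 - informed_error p0 ch \<epsilon> R n f g
    \<le> 2 * measure_pmf.prob (seq_joint p0 ch n)
            {(x, y). \<not> pmf (memoryless ch n x) y \<le> 2 powr (real n * (J + \<delta>)) * pmf (iid q n) y}
      + 2 * measure_pmf.prob (iid q n) {y. \<not> pmf (iid q n) y \<le> 2 powr (- (real n * (H - \<delta>)))}
      + 5 * 2 powr (- (real n * \<delta>))"
proof -
  define P where "P = codeword p0 \<epsilon> n"
  define I where "I = {1..num_idx R n}"
  \<comment> \<open>\<open>u\<close> caps typical output probabilities and \<open>v\<close> the
    typical likelihood ratio. The threshold \<open>a\<close> lies below
    \<open>2 powr (- (n * R2))\<close> and above \<open>u\<close>, each time by a factor of at least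
    \<open>2 powr (n * \<delta>)\<close>.\<close>
  define u where "u = 2 powr (- (real n * (H - \<delta>)))"
  define v where "v = 2 powr (real n * (J + \<delta>))"
  define a where "a = 2 powr (- (real n * (R2 + \<delta>)))"
  define G1 where "G1 = {(x, y). \<not> pmf (memoryless ch n x) y \<le> v * pmf (iid q n) y}"
  define G2 where "G2 = {y. \<not> pmf (iid q n) y \<le> u}"
  define G where "G = {(x, y). pmf (memoryless ch n x) y \<le> v * pmf (iid q n) y \<and> pmf (iid q n) y \<le> u}"
  define S where "S C = {y. g (f y C) C = y}" for C
  have uv: "u > 0" "v > 0" "a > 0" by (simp_all add: u_def v_def a_def)
  have I: "finite I" "I \<noteq> {}" using num_idx_ge_1[OF R(2), of n] by (auto simp: I_def)
  have ne: "set_pmf (iid p0 n) \<inter> strongly_typical p0 \<epsilon> n \<noteq> {}"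
    using half by (intro set_pmf_Int_nonempty) auto
  have setP: "set_pmf P = set_pmf (iid p0 n) \<inter> strongly_typical p0 \<epsilon> n"
    unfolding P_def codeword_def using ne by (rule set_cond_pmf)
  have P: "finite (set_pmf P)" unfolding setP using finite_set_iid by blast
  have expP: "measure_pmf.expectation P h \<le> 2 * measure_pmf.expectation (iid p0 n) h"
    if "\<And>x. h x \<ge> 0" for h :: "_ \<Rightarrow> real"
  proof -
    have "measure_pmf.expectation P h \<le> measure_pmf.expectation (iid p0 n) h
        / measure_pmf.prob (iid p0 n) (strongly_typical p0 \<epsilon> n)"
      unfolding P_def codeword_def using that by (intro expectation_cond_pmf_le finite_set_iid ne)
    also have "\<dots> \<le> measure_pmf.expectation (iid p0 n) h / (1 / 2)"
      using half that by (intro divide_left_mono integral_nonneg_AE) auto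
    finally show ?thesis by simp
  qed
  have "measure_pmf.prob (codebook_output p0 ch \<epsilon> R n) {(C, y). y \<in> S C}
      \<le> measure_pmf.prob (do {x \<leftarrow> P; y \<leftarrow> memoryless ch n x; return_pmf (x, y)}) (- G)
             + a * 2 powr (real n * R2) + (v * u / real (card I) + 2 * u) / a"
    unfolding codebook_output_def random_codebook_def I_def[symmetric] P_def[symmetric]
  proof (rule informed_success_le[where B = "block n"])
    fix x y assume "(x, y) \<in> G"
    hence "pmf (memoryless ch n x) y \<le> v * pmf (iid q n) y" "pmf (iid q n) y \<le> u"
      by (auto simp: G_def)
    thus "pmf (memoryless ch n x) y \<le> v * u"
      using uv by (meson mult_left_mono less_imp_le order.trans)
  next
    fix y :: "nat \<Rightarrow> 'y"
    have "measure_pmf.expectation P (\<lambda>x. pmf (memoryless ch n x) y * indicator G (x, y))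
        \<le> 2 * measure_pmf.expectation (iid p0 n) (\<lambda>x. pmf (memoryless ch n x) y * indicator G (x, y))"
      by (rule expP) auto
    \<comment> \<open>If \<open>y\<close> is too likely, no pair with output \<open>y\<close> is in
      \<open>G\<close>. Otherwise, dropping the indicator leaves the i.i.d. output probability of
      \<open>y\<close>.\<close>
    also have "measure_pmf.expectation (iid p0 n) (\<lambda>x. pmf (memoryless ch n x) y * indicator G (x, y)) \<le> u"
    proof (cases "pmf (iid q n) y \<le> u")
      case True
      have "measure_pmf.expectation (iid p0 n) (\<lambda>x. pmf (memoryless ch n x) y * indicator G (x, y))
          \<le> measure_pmf.expectation (iid p0 n) (\<lambda>x. pmf (memoryless ch n x) y)"
        by (intro integral_mono_AE integrable_measure_pmf_finite finite_set_iid AE_pmfI)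
          (auto simp: indicator_def)
      also have "\<dots> = pmf (iid q n) y" by (simp add: q_def iid_bind pmf_bind)
      finally show ?thesis using True by simp
    next
      case False
      thus ?thesis using uv by (simp add: G_def)
    qed
    finally show "measure_pmf.expectation P (\<lambda>x. pmf (memoryless ch n x) y * indicator G (x, y)) \<le> 2 * u"
      by simp
  next
    fix C assume C: "C \<in> set_pmf (Pi_pmf I undefined (\<lambda>_. P))"
    have "C i \<in> block n" if "i \<in> I" for i
      using C I that set_iid_block by (fastforce simp: set_Pi_pmf PiE_dflt_def setP)
    moreover have "C i = undefined" if "i \<notin> I" for i
      using C I that by (auto simp: set_Pi_pmf PiE_dflt_def)
    ultimately have "C \<in> codebooks R n" by (auto simp: codebooks_def I_def)
    \<comment> \<open>A correctly decoded \<open>y\<close> equals \<open>g i C\<close> for its index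
      \<open>i = f y C\<close>, so a fixed codebook allows no more such outputs than there are
      indices.\<close>
    hence "S C \<inter> block n \<subseteq> (\<lambda>i. g i C) ` {1..num_idx R2 n}"
      using code by (force simp: S_def informed_code_def Pi_iff)
    hence "card (S C \<inter> block n) \<le> card {1..num_idx R2 n}" by (rule surj_card_le[rotated]) simp
    thus "real (card (S C \<inter> block n)) \<le> 2 powr (real n * R2)"
      using num_idx_le[of R2 n] by simp
  next
    show "set_pmf (memoryless ch n x) \<subseteq> block n" for x by (rule set_memoryless_block)
  qed (use I P uv in \<open>simp_all add: finite_block\<close>)
  also have "measure_pmf.prob (do {x \<leftarrow> P; y \<leftarrow> memoryless ch n x; return_pmf (x, y)}) (- G)
      \<le> 2 * measure_pmf.prob (seq_joint p0 ch n) (- G)"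
    unfolding P_def seq_joint_def by (rule prob_bind_codeword_le[OF half])
  also have "measure_pmf.prob (seq_joint p0 ch n) (- G)
      \<le> measure_pmf.prob (seq_joint p0 ch n) (G1 \<union> {(x, y). y \<in> G2})"
    by (rule measure_pmf.finite_measure_mono) (auto simp: G_def G1_def G2_def)
  also have "\<dots> \<le> measure_pmf.prob (seq_joint p0 ch n) G1
      + measure_pmf.prob (seq_joint p0 ch n) {(x, y). y \<in> G2}"
    by (rule measure_Un_le) auto
  also have "measure_pmf.prob (seq_joint p0 ch n) {(x, y). y \<in> G2} = measure_pmf.prob (iid q n) G2"
    unfolding q_def iid_bind seq_joint_def map_pmf_def[symmetric]
    by (simp add: measure_bind_pmf_expectation vimage_def)
  also have "a * 2 powr (real n * R2) = 2 powr (- (real n * \<delta>))"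
    by (simp add: a_def powr_add[symmetric] algebra_simps)
  also have "(v * u / real (card I) + 2 * u) / a \<le> 4 * 2 powr (- (real n * \<delta>))"
  proof -
    \<comment> \<open>Here the rate condition enters: the codebook has at least \<open>v / 2\<close>
      codewords, which averages out the peaks of the single channel laws.\<close>
    have "v \<le> 2 powr (real n * R)" unfolding v_def using R by (intro powr_mono mult_left_mono) auto
    also have "\<dots> \<le> 2 * real (card I)" using num_idx_ge_half[OF R(2), of n] by (simp add: I_def)
    finally have "v * u \<le> 2 * real (card I) * u" using uv by (intro mult_right_mono) auto
    hence "v * u / real (card I) \<le> 2 * u"
      using I by (simp add: card_gt_0_iff divide_le_eq mult_ac)
    hence "(v * u / real (card I) + 2 * u) / a \<le> 4 * (u / a)"
      using uv by (simp add: divide_right_mono)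
    also have "u / a = 2 powr (real n * (R2 + 2 * \<delta> - H))"
      by (simp add: u_def a_def powr_diff[symmetric] algebra_simps)
    also have "\<dots> \<le> 2 powr (real n * (- \<delta>))"
      using H by (intro powr_mono mult_left_mono) auto
    finally show ?thesis by simp
  qed
  also have "measure_pmf.prob (codebook_output p0 ch \<epsilon> R n) {(C, y). y \<in> S C}
      = 1 - informed_error p0 ch \<epsilon> R n f g"
  proof -
    have "- {(C, y). y \<in> S C} = {(C, y). g (f y C) C \<noteq> y}" by (auto simp: S_def)
    thus ?thesis
      using measure_pmf.prob_compl[of "{(C, y). y \<in> S C}" "codebook_output p0 ch \<epsilon> R n"]
      by (simp add: informed_error_def Compl_eq_Diff_UNIV)
  qed
  finally show ?thesis
    by (simp add: G1_def G2_def u_def v_def)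
qed

lemma informed_strong_converse:
  fixes p0 :: "'x::finite pmf" and ch :: "'x \<Rightarrow> 'y::finite pmf"
  assumes "\<epsilon> > 0" "R > mutual_info p0 ch" "R2 < output_entropy p0 ch"
    and code: "\<And>n. informed_code R R2 n (f n) (g n)"
  shows "(\<lambda>n. informed_error p0 ch \<epsilon> R n (f n) (g n)) \<longlonglongrightarrow> 1"
proof -
  define q where "q = bind_pmf p0 ch"
  define J where "J = mutual_info p0 ch"
  define H where "H = output_entropy p0 ch"
  \<comment> \<open>Small enough for both requirements of \<open>informed_success_bound\<close>, the
    rate gap above \<open>J\<close> and the triple gap below \<open>H\<close>.\<close>
  define \<delta> where "\<delta> = min (R - J) ((H - R2) / 3)"
  have \<delta>: "\<delta> > 0" "R \<ge> J + \<delta>" "R2 + 3 * \<delta> \<le> H"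
    using assms by (auto simp: \<delta>_def J_def H_def min_def field_simps)
  have R: "R \<ge> 0" using assms(2) mutual_info_nonneg[of p0 ch] by simp
  define e1 where "e1 n = measure_pmf.prob (seq_joint p0 ch n)
      {(x, y). \<not> pmf (memoryless ch n x) y \<le> 2 powr (real n * (J + \<delta>)) * pmf (iid q n) y}" for n
  define e2 where "e2 n = measure_pmf.prob (iid q n)
      {y. \<not> pmf (iid q n) y \<le> 2 powr (- (real n * (H - \<delta>)))}" for n
  define e3 where "e3 n = measure_pmf.prob (iid q n)
      {y. \<not> (2 powr (- (real n * (H + \<delta>))) \<le> pmf (iid q n) y \<and>
             pmf (iid q n) y \<le> 2 powr (- (real n * (H - \<delta>))))}" for n
  have "e1 \<longlonglongrightarrow> 0"
    using information_density_aep[OF \<delta>(1), of p0 ch] by (simp add: e1_def[abs_def] q_def J_def)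
  moreover have "e3 \<longlonglongrightarrow> 0"
    using iid_output_aep[OF \<delta>(1), of p0 ch] by (simp add: e3_def[abs_def] q_def H_def)
  moreover have "(\<lambda>n. 2 powr (- (real n * \<delta>))) \<longlonglongrightarrow> 0"
    using \<delta>(1) by real_asymp
  ultimately have "(\<lambda>n. 1 - (2 * e1 n + 2 * e3 n + 5 * 2 powr (- (real n * \<delta>)))) \<longlonglongrightarrow>
      1 - (2 * 0 + 2 * 0 + 5 * 0)"
    by (intro tendsto_intros)
  hence lim: "(\<lambda>n. 1 - (2 * e1 n + 2 * e3 n + 5 * 2 powr (- (real n * \<delta>)))) \<longlonglongrightarrow> 1" by simp
  \<comment> \<open>The converse needs only the upper half of two-sided typicality.\<close>
  have "e2 n \<le> e3 n" for n
    unfolding e2_def e3_def by (rule measure_pmf.finite_measure_mono) auto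
  have "\<forall>\<^sub>F n in sequentially. 1 - (2 * e1 n + 2 * e3 n + 5 * 2 powr (- (real n * \<delta>)))
      \<le> informed_error p0 ch \<epsilon> R n (f n) (g n)"
    using eventually_typical_prob_ge_half[OF assms(1), of p0]
  proof eventually_elim
    case (elim n)
    show ?case
      using informed_success_bound[OF code \<delta>(2) R elim \<delta>(3), of ch] \<open>e2 n \<le> e3 n\<close>
      by (simp add: e1_def e2_def q_def)
  qed
  from tendsto_sandwich[OF this _ lim tendsto_const] show ?thesis
    by (simp add: informed_error_def)
qed

theorem mainTheorem4:
  fixes p0 :: "'x::finite pmf" and ch :: "'x \<Rightarrow> 'y::finite pmf" and \<epsilon> R :: real
  assumes "\<epsilon> > 0" and "R > mutual_info p0 ch"
  shows "(\<forall>R1 > output_entropy p0 ch.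
            \<exists>f g. (\<forall>n. blind_code R1 n (f n) (g n)) \<and>
                  (\<lambda>n. blind_error p0 ch \<epsilon> R n (f n) (g n)) \<longlonglongrightarrow> 0)
       \<and> (\<forall>R2 < output_entropy p0 ch.
            \<forall>f g. (\<forall>n. informed_code R R2 n (f n) (g n)) \<longrightarrow>
                  0 < liminf (\<lambda>n. ereal (informed_error p0 ch \<epsilon> R n (f n) (g n))))"
proof (intro conjI allI impI)
  fix R1 assume "R1 > output_entropy p0 ch"
  \<comment> \<open>A nonnegative rate ensures that the codebook has at least one codeword.\<close>
  moreover have "R \<ge> 0" using assms(2) mutual_info_nonneg[of p0 ch] by simp
  ultimately show "\<exists>f g. (\<forall>n. blind_code R1 n (f n) (g n)) \<and>
      (\<lambda>n. blind_error p0 ch \<epsilon> R n (f n) (g n)) \<longlonglongrightarrow> 0"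
    using assms(1) by (intro blind_achievability)
next
  fix R2 and f :: "nat \<Rightarrow> (nat \<Rightarrow> 'y) \<Rightarrow> (nat \<Rightarrow> nat \<Rightarrow> 'x) \<Rightarrow> nat"
    and g :: "nat \<Rightarrow> nat \<Rightarrow> (nat \<Rightarrow> nat \<Rightarrow> 'x) \<Rightarrow> nat \<Rightarrow> 'y"
  assume "R2 < output_entropy p0 ch" "\<forall>n. informed_code R R2 n (f n) (g n)"
  hence "(\<lambda>n. informed_error p0 ch \<epsilon> R n (f n) (g n)) \<longlonglongrightarrow> 1"
    using assms by (intro informed_strong_converse) auto
  hence "liminf (\<lambda>n. ereal (informed_error p0 ch \<epsilon> R n (f n) (g n))) = ereal 1"
    by (intro lim_imp_Liminf tendsto_ereal) auto
  thus "0 < liminf (\<lambda>n. ereal (informed_error p0 ch \<epsilon> R n (f n) (g n)))"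
    by simp
qed

end
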